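(* Let $1<p\le q<\infty$, $b_0,c_0,\beta,\gamma\in\mathbb{R}$, let $K:(0,\infty)\times(0,\infty)\to\mathbb{C}$ be measurable and bounded on compact subsets of $(0,\infty)\times(0,\infty)$, and let $$Ff(y)=y^{c_0}\int_0^\infty x^{b_0}f(x)K(x,y)\,dx,\qquad y>0.$$ Assume that the inequality $$\Vert y^{-\beta}Ff\Vert_q\lesssim\Vert x^\gamma f\Vert_p$$ holds, with a constant independent of $f$, for all measurable $f:(0,\infty)\to\mathbb{C}$ such that the integral defining $Ff(y)$ converges absolutely for every $y>0$. (i) If $b_1,c_1\in\mathbb{R}$ and $K(x,y)\asymp x^{b_1}y^{c_1}$ for $xy\le1$, then $$\beta=\gamma+c_0-b_0+c_1-b_1+\frac1q-\frac1{p'},\qquad \beta<\frac1q+c_0+c_1.$$ (ii) If $b_2,c_2\in\mathbb{R}$ and $K(x,y)\asymp x^{b_2}y^{c_2}$ for $xy>1$, then $$\beta=\gamma+c_0-b_0+c_2-b_2+\frac1q-\frac1{p'},\qquad \beta>\frac1q+c_0+c_2.$$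
   Context: Notation: $p'=p/(p-1)$; $\Vert g\Vert_p=\big(\int_0^\infty|g(x)|^p\,dx\big)^{1/p}$ (possibly $+\infty$). $A\lesssim B$ means $A\le cB$ with $c>0$ independent of $x,y,f$; $A\asymp B$ means $A\lesssim B\lesssim A$ (in particular $K$ is real and positive in the region where $K\asymp\cdots$ is assumed). *)

theory Defs
  imports "HOL-Analysis.Analysis"
begin

abbreviation half_line :: "real measure" where
  "half_line \<equiv> lebesgue_on {0<..}"

abbreviation quadrant :: "(real \<times> real) set" where
  "quadrant \<equiv> {0<..} \<times> {0<..}"

(* The norm takes values in [0, \<infinity>]. The infinite case is separated because enn2real sends
   \<infinity> to 0. *)
definition lnorm :: "real \<Rightarrow> (real \<Rightarrow> complex) \<Rightarrow> ennreal" where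
  "lnorm p g =
     (let I = (\<integral>\<^sup>+x. ennreal (norm (g x) powr p) \<partial>half_line)
      in if I = \<infinity> then \<infinity> else ennreal (enn2real I powr (1 / p)))"

definition conjugate_exponent :: "real \<Rightarrow> real" where
  "conjugate_exponent p = p / (p - 1)"

(* For a kernel that is only Lebesgue measurable in the plane, the sections K(-, y) are measurable
   merely for almost every y, while the transform below is an integral against every section with
   y > 0. Hence the second conjunct; Borel kernels satisfy it automatically, see
   measurable_kernel_if_borel. *)
definition measurable_kernel :: "(real \<Rightarrow> real \<Rightarrow> complex) \<Rightarrow> bool" where
  "measurable_kernel K \<longleftrightarrow>
     (\<lambda>(x, y). K x y) \<in> borel_measurable (lebesgue_on quadrant) \<and>
     (\<forall>y>0. (\<lambda>x. K x y) \<in> borel_measurable half_line)"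

lemma measurable_kernel_if_borel:
  assumes "(\<lambda>(x, y). K x y) \<in> borel_measurable (restrict_space borel quadrant)"
  shows "measurable_kernel K"
proof -
  have open_quadrant: "open quadrant"
    by (intro open_Times open_greaterThan)
  define H where "H = (\<lambda>z. if z \<in> quadrant then (case z of (x, y) \<Rightarrow> K x y) else 0)"
  have H: "H \<in> borel_measurable borel"
    unfolding H_def using assms open_quadrant
    by (subst (asm) measurable_restrict_space_iff[where c = 0]) auto
  have "H \<in> borel_measurable lebesgue"
    using H by (simp add: measurable_completion)
  then have "H \<in> borel_measurable (lebesgue_on quadrant)"
    by (rule measurable_restrict_space1)
  then have "(\<lambda>(x, y). K x y) \<in> borel_measurable (lebesgue_on quadrant)"
    by (rule measurable_cong[THEN iffD1, rotated]) (auto simp: H_def space_restrict_space)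
  moreover have "(\<lambda>x. K x y) \<in> borel_measurable half_line" if "y > 0" for y
  proof -
    have "(\<lambda>x. (x, y)) \<in> borel_measurable borel"
      by (intro borel_measurable_continuous_onI continuous_intros)
    then have "(\<lambda>x. H (x, y)) \<in> borel_measurable borel"
      by (rule measurable_compose) (rule H)
    then have "(\<lambda>x. H (x, y)) \<in> borel_measurable half_line"
      by (intro measurable_restrict_space1 measurable_completion) simp
    then show ?thesis
      by (rule measurable_cong[THEN iffD1, rotated])
         (auto simp: H_def space_restrict_space that)
  qed
  ultimately show ?thesis
    unfolding measurable_kernel_def by blast
qed

definition transform_integrand ::
    "real \<Rightarrow> (real \<Rightarrow> real \<Rightarrow> complex) \<Rightarrow> (real \<Rightarrow> complex) \<Rightarrow> real \<Rightarrow> real \<Rightarrow> complex" where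
  "transform_integrand b0 K f y x = of_real (x powr b0) * f x * K x y"

definition transform ::
    "real \<Rightarrow> real \<Rightarrow> (real \<Rightarrow> real \<Rightarrow> complex) \<Rightarrow> (real \<Rightarrow> complex) \<Rightarrow> real \<Rightarrow> complex" where
  "transform b0 c0 K f y =
     of_real (y powr c0) * (LINT x|half_line. transform_integrand b0 K f y x)"

definition lesssim_on :: "'a set \<Rightarrow> ('a \<Rightarrow> real) \<Rightarrow> ('a \<Rightarrow> real) \<Rightarrow> bool" where
  "lesssim_on S A B \<longleftrightarrow> (\<exists>c>0. \<forall>t\<in>S. A t \<le> c * B t)"

definition asymp_on_set :: "'a set \<Rightarrow> ('a \<Rightarrow> real) \<Rightarrow> ('a \<Rightarrow> real) \<Rightarrow> bool" where
  "asymp_on_set S A B \<longleftrightarrow> lesssim_on S A B \<and> lesssim_on S B A"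

(* Positivity of K on S is a consequence: x powr b * y powr c > 0 for x, y > 0. *)
definition kernel_asymp ::
    "(real \<times> real) set \<Rightarrow> (real \<Rightarrow> real \<Rightarrow> complex) \<Rightarrow> real \<Rightarrow> real \<Rightarrow> bool" where
  "kernel_asymp S K b c \<longleftrightarrow>
     (\<forall>(x, y)\<in>S. K x y \<in> \<real>) \<and>
     asymp_on_set S (\<lambda>(x, y). Re (K x y)) (\<lambda>(x, y). x powr b * y powr c)"

end

theory Submission
  imports Defs
begin

text \<open>
  A kernel that is bounded below by a multiple of \<open>x\<^sup>b y\<^sup>c\<close> on one side of the
  hyperbola \<open>x y = 1\<close> is tested on one function, dilated by every scale \<open>a > 0\<close>: the
  function \<open>f\<^sub>a x = x powr (- b0 - b)\<close> on \<open>[a, 2 a]\<close> and zero elsewhere. As its support is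
  compact, the transform converges absolutely by local boundedness of the kernel alone, although
  nothing is known about the kernel on the other side of the hyperbola. The exponent makes the
  integrand at least a constant multiple of \<open>y\<^sup>c\<close> on the support.

  The set of those \<open>y\<close> for which \<open>[a, 2 a] \<times> {y}\<close> lies on the good side contains \<open>{y. a y \<in> E}\<close>,
  where \<open>E = (0, 1/2]\<close> below the hyperbola and \<open>E = (1, \<infinity>)\<close> above it. There the transform is at
  least a constant times \<open>a y powr (c0 + c)\<close>. With \<open>s = q (c0 + c - \<beta>)\<close>, the \<open>q\<close>-th power of the
  left-hand norm is therefore at least a constant times \<open>a powr (q - s - 1)\<close> times the integral
  of \<open>y powr s\<close> over \<open>E\<close>, while the right-hand norm is exactly a finite constant times a power
  of \<open>a\<close>. This has two consequences (\<open>homogeneous_kernel_necessary\<close>). Since the estimate holds for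
  all \<open>a > 0\<close>, both small and large, the two powers of \<open>a\<close> agree, which is the equation for \<open>\<beta>\<close>.
  And \<open>y powr s\<close> is integrable over \<open>E\<close>.

  Integrability gives the strict inequality for \<open>\<beta>\<close> without evaluating an integral
  (\<open>power_mass_shrink_exponent\<close>). A dilation by a suitable factor maps \<open>E\<close> into itself and misses an
  interval, so it strictly decreases the finite integral of \<open>y powr s\<close>; but it multiplies
  that integral by a power of the factor with exponent \<open>\<plusminus>(s + 1)\<close>, which fixes the sign
  of \<open>s + 1\<close>.
\<close>

section \<open>Power weights on the half-line\<close>

lemma nn_integral_half_line:
  assumes "f \<in> borel_measurable borel"
  shows "(\<integral>\<^sup>+x. f x \<partial>half_line) = (\<integral>\<^sup>+x. f x * indicator {0<..} x \<partial>lborel)"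
  using assms by (simp add: nn_integral_restrict_space nn_integral_completion)

definition power_mass :: "real \<Rightarrow> real set \<Rightarrow> ennreal" where
  "power_mass s E = (\<integral>\<^sup>+x. ennreal (x powr s) * indicator E x \<partial>half_line)"

lemma power_mass_dilate:
  assumes E: "E \<in> sets borel" and a: "0 < a"
  shows "power_mass s {x. a * x \<in> E} = ennreal (a powr (- s - 1)) * power_mass s E"
proof -
  have [measurable]: "E \<in> sets borel" by (fact E)
  have [measurable]: "{x. a * x \<in> E} \<in> sets borel" by measurable
  let ?g = "\<lambda>x. ennreal (x powr s) * indicator E x * indicator {0<..} x"
  have "ennreal (a powr (- s - 1)) * power_mass s E
      = ennreal (a powr (- s - 1)) * (\<integral>\<^sup>+x. ?g x \<partial>lborel)"
    by (simp add: power_mass_def nn_integral_half_line)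
  also have "\<dots> = ennreal (a powr (- s - 1)) * (ennreal a * (\<integral>\<^sup>+x. ?g (a * x) \<partial>lborel))"
    using a nn_integral_real_affine[of ?g a 0] by simp
  also have "\<dots> = (\<integral>\<^sup>+x. ennreal (a powr (- s - 1)) * (ennreal a * ?g (a * x)) \<partial>lborel)"
    by (simp add: nn_integral_cmult)
  also have "\<dots> = (\<integral>\<^sup>+x. ennreal (x powr s) * indicator {x. a * x \<in> E} x * indicator {0<..} x \<partial>lborel)"
  proof (intro nn_integral_cong)
    fix x :: real
    have "a powr (- s - 1) * (a * (a * x) powr s) = x powr s" if "x > 0"
      using a that by (simp add: powr_mult powr_diff powr_minus field_simps)
    then show "ennreal (a powr (- s - 1)) * (ennreal a * ?g (a * x))
        = ennreal (x powr s) * indicator {x. a * x \<in> E} x * indicator {0<..} x"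
      using a by (auto simp: indicator_def zero_less_mult_iff simp flip: ennreal_mult)
  qed
  also have "\<dots> = power_mass s {x. a * x \<in> E}"
    by (simp add: power_mass_def nn_integral_half_line)
  finally show ?thesis by simp
qed

lemma power_mass_interval_pos:
  assumes "E \<in> sets borel" and "{u<..<v} \<subseteq> E" and "0 \<le> u" and "u < v"
  shows "0 < power_mass s E"
proof (rule ccontr)
  have [measurable]: "E \<in> sets borel" by (fact assms)
  assume "\<not> 0 < power_mass s E"
  then have "(\<integral>\<^sup>+x. ennreal (x powr s) * indicator E x * indicator {0<..} x \<partial>lborel) = 0"
    by (simp add: power_mass_def nn_integral_half_line)
  then have "AE x in lborel. ennreal (x powr s) * indicator E x * indicator {0<..} x = 0"
    by (subst (asm) nn_integral_0_iff_AE) auto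
  then have "AE x in lborel. x \<notin> {u<..<v}"
  proof eventually_elim
    case (elim x)
    then show ?case using assms by (auto simp: indicator_def split: if_splits)
  qed
  then have "{u<..<v} \<in> null_sets lborel"
    by (subst AE_iff_null_sets) auto
  then show False
    using assms by (auto simp: null_sets_def)
qed

lemma power_mass_compact_finite:
  assumes "0 < u"
  shows "power_mass s {u..v} < \<infinity>"
proof -
  have "continuous_on {u..v} (\<lambda>x. x powr s)"
    using assms by (intro continuous_intros) auto
  then have "bounded ((\<lambda>x. x powr s) ` {u..v})"
    using compact_continuous_image compact_imp_bounded compact_Icc by blast
  then obtain B where B: "\<And>x. x \<in> {u..v} \<Longrightarrow> x powr s \<le> B"
    unfolding bounded_iff by fastforce
  have "power_mass s {u..v}
      = (\<integral>\<^sup>+x. ennreal (x powr s) * indicator {u..v} x * indicator {0<..} x \<partial>lborel)"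
    by (simp add: power_mass_def nn_integral_half_line)
  also have "\<dots> \<le> (\<integral>\<^sup>+x. ennreal B * indicator {u..v} x \<partial>lborel)"
    by (intro nn_integral_mono) (auto simp: indicator_def intro!: ennreal_leI B)
  also have "\<dots> = ennreal B * emeasure lborel {u..v}"
    by (simp add: nn_integral_cmult)
  also have "\<dots> < \<infinity>"
    by (cases "u \<le> v") (auto simp: ennreal_mult_less_top)
  finally show ?thesis .
qed

text \<open>
  The mass of \<open>{x. a * x \<in> E}\<close> is the mass of \<open>E\<close> times \<open>a powr (- s - 1)\<close>. If that set
  is a proper part of \<open>E\<close>, missing an interval and hence positive mass, the factor must be below
  one as soon as the mass of \<open>E\<close> is finite. For \<open>E = (0, 1/2]\<close> and \<open>E = (1, \<infinity>)\<close> this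
  is the familiar condition necessary for convergence of the integral of a power at \<open>0\<close> and
  at \<open>\<infinity>\<close>.
\<close>

lemma power_mass_shrink_exponent:
  assumes E: "E \<in> sets borel" and a: "0 < a"
    and sub: "\<And>x. a * x \<in> E \<Longrightarrow> x \<in> E"
    and gap: "{u<..<v} \<subseteq> E - {x. a * x \<in> E}" "0 \<le> u" "u < v"
    and fin: "power_mass s E < \<infinity>"
  shows "a powr (- s - 1) < 1"
proof -
  let ?E' = "{x. a * x \<in> E}"
  have [measurable]: "E \<in> sets borel" by (fact E)
  have E'[measurable]: "?E' \<in> sets borel" by measurable
  have "power_mass s E = (\<integral>\<^sup>+x. ennreal (x powr s) * indicator ?E' x * indicator {0<..} x
      + ennreal (x powr s) * indicator (E - ?E') x * indicator {0<..} x \<partial>lborel)"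
    unfolding power_mass_def using sub
    by (auto simp: nn_integral_half_line indicator_def intro!: nn_integral_cong)
  also have "\<dots> = power_mass s ?E' + power_mass s (E - ?E')"
    by (simp add: nn_integral_add power_mass_def nn_integral_half_line)
  also have "power_mass s ?E' = ennreal (a powr (- s - 1)) * power_mass s E"
    by (rule power_mass_dilate) fact+
  finally have split: "power_mass s E
      = ennreal (a powr (- s - 1)) * power_mass s E + power_mass s (E - ?E')" .
  have "0 < power_mass s (E - ?E')"
    by (rule power_mass_interval_pos) (use gap in auto)
  then have lt: "ennreal (a powr (- s - 1)) * power_mass s E < power_mass s E"
    using split fin
    by (metis add.right_neutral ennreal_add_left_cancel_less infinity_ennreal_def
        le_iff_add order_le_less_trans)
  show ?thesis
  proof (rule ccontr)
    assume "\<not> a powr (- s - 1) < 1"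
    then have "1 * power_mass s E \<le> ennreal (a powr (- s - 1)) * power_mass s E"
      by (intro mult_right_mono) auto
    with lt show False by simp
  qed
qed

section \<open>Norms and comparison of powers\<close>

text \<open>
  A finite bound on the norm excludes the case of an infinite integral, so the integral is recovered
  from the norm by taking the \<open>q\<close>-th power.
\<close>

lemma lnorm_le_imp_nn_integral_le:
  assumes "lnorm q g \<le> ennreal B" and "0 < q" and "0 \<le> B"
  shows "(\<integral>\<^sup>+x. ennreal (norm (g x) powr q) \<partial>half_line) \<le> ennreal (B powr q)"
proof -
  let ?I = "\<integral>\<^sup>+x. ennreal (norm (g x) powr q) \<partial>half_line"
  have fin: "?I \<noteq> \<infinity>"
    using assms by (auto simp: lnorm_def Let_def top_unique)
  then have "enn2real ?I powr (1 / q) \<le> B"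
    using assms by (simp add: lnorm_def Let_def)
  then have "(enn2real ?I powr (1 / q)) powr q \<le> B powr q"
    using assms by (intro powr_mono2) auto
  then have "enn2real ?I \<le> B powr q"
    using assms by (simp add: powr_powr)
  then show ?thesis
    using fin by (metis ennreal_enn2real ennreal_leI infinity_ennreal_def less_top)
qed

text \<open>
  With \<open>m \<noteq> n\<close>, the ratio \<open>a powr (m - n)\<close> takes every positive value as \<open>a\<close> varies, so no
  inequality between the two powers can hold at all scales.
\<close>

lemma powr_dominated_imp_eq:
  fixes L U m n :: real
  assumes "0 < L" and "0 < U" and le: "\<And>a. 0 < a \<Longrightarrow> L * a powr m \<le> U * a powr n"
  shows "m = n"
proof (rule ccontr)
  assume "m \<noteq> n"
  \<comment> \<open>This scale makes the left side exactly twice the right side.\<close>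
  define a where "a = (2 * U / L) powr (1 / (m - n))"
  have a: "0 < a" using assms by (simp add: a_def)
  have "a powr m = a powr (m - n) * a powr n"
    by (simp flip: powr_add)
  also have "a powr (m - n) = 2 * U / L"
    using \<open>m \<noteq> n\<close> assms by (simp add: a_def powr_powr)
  finally have "L * a powr m = 2 * (U * a powr n)"
    using assms by simp
  moreover have "0 < U * a powr n" using a assms by simp
  ultimately show False using le[OF a] by linarith
qed

section \<open>Testing the inequality on truncated powers\<close>

definition window_power :: "real \<Rightarrow> real \<Rightarrow> real \<Rightarrow> complex" where
  "window_power r a x = of_real (x powr r * indicator {a..2 * a} x)"

lemma window_power_measurable: "window_power r a \<in> borel_measurable half_line"
proof -
  have "window_power r a \<in> borel_measurable borel"
    unfolding window_power_def[abs_def] by measurable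
  then show ?thesis
    by (intro measurable_restrict_space1 measurable_completion) simp
qed

text \<open>
  The \<open>p\<close>-th power of the norm is the mass of \<open>[a, 2 a]\<close> for the weight with exponent
  \<open>(\<gamma> + r) p\<close>, and \<open>[a, 2 a]\<close> is the dilate of \<open>[1, 2]\<close>, so the scaling law for power weights
  makes the dependence on \<open>a\<close> explicit.
\<close>

lemma window_power_norm:
  assumes "0 < a" and "0 < p"
  shows "lnorm p (\<lambda>x. of_real (x powr \<gamma>) * window_power r a x)
    = ennreal ((a powr ((\<gamma> + r) * p + 1) * enn2real (power_mass ((\<gamma> + r) * p) {1..2})) powr (1 / p))"
proof -
  let ?t = "(\<gamma> + r) * p"
  have "(\<integral>\<^sup>+x. ennreal (norm (of_real (x powr \<gamma>) * window_power r a x) powr p) \<partial>half_line)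
      = power_mass ?t {a..2 * a}"
    unfolding power_mass_def
    by (rule nn_integral_cong)
      (auto simp: window_power_def indicator_def norm_mult powr_powr simp flip: powr_add)
  also have "{a..2 * a} = {x. (1 / a) * x \<in> {1..2}}"
    using assms by (auto simp: field_simps)
  also have "power_mass ?t \<dots> = ennreal ((1 / a) powr (- ?t - 1)) * power_mass ?t {1..2}"
    using assms by (intro power_mass_dilate) auto
  also have "(1 / a) powr (- ?t - 1) = a powr (?t + 1)"
    using assms by (simp add: powr_divide powr_minus powr_diff powr_add field_simps)
  also have "power_mass ?t {1..2} = ennreal (enn2real (power_mass ?t {1..2}))"
    using power_mass_compact_finite[of 1 ?t 2] by simp
  finally have "(\<integral>\<^sup>+x. ennreal (norm (of_real (x powr \<gamma>) * window_power r a x) powr p) \<partial>half_line)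
      = ennreal (a powr (?t + 1) * enn2real (power_mass ?t {1..2}))"
    by (simp add: ennreal_mult)
  then show ?thesis
    by (simp add: lnorm_def Let_def)
qed

text \<open>
  For fixed \<open>y\<close> the integrand lives on the compact set \<open>[a, 2 a] \<times> {y}\<close>, where the kernel is
  bounded. This holds for every \<open>y > 0\<close>, also where no asymptotics of the kernel is assumed, so
  each window is an admissible test function.
\<close>

lemma window_power_integrable:
  assumes K: "measurable_kernel K"
    and bdd: "\<And>S. compact S \<Longrightarrow> S \<subseteq> quadrant \<Longrightarrow> bounded ((\<lambda>(x, y). K x y) ` S)"
    and "0 < a" and "0 < y"
  shows "integrable half_line (transform_integrand b0 K (window_power r a) y)"
proof -
  have "continuous_on {a..2 * a} (\<lambda>x. x powr (b0 + r))"
    using assms by (intro continuous_intros) auto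
  then have "bounded ((\<lambda>x. x powr (b0 + r)) ` {a..2 * a})"
    using compact_continuous_image compact_imp_bounded compact_Icc by blast
  then obtain A where A: "\<And>x. x \<in> {a..2 * a} \<Longrightarrow> x powr (b0 + r) \<le> A"
    unfolding bounded_iff by fastforce
  have "bounded ((\<lambda>(x, y). K x y) ` ({a..2 * a} \<times> {y}))"
    using assms by (intro bdd compact_Times) auto
  then obtain B where B: "\<And>x. x \<in> {a..2 * a} \<Longrightarrow> norm (K x y) \<le> B"
    unfolding bounded_iff by fastforce
  show ?thesis
  proof (rule integrableI_bounded_set[where A = "{a..2 * a}" and B = "A * B"])
    show "{a..2 * a} \<in> sets half_line"
      using assms by (auto simp: sets_restrict_space_iff)
    have [measurable]: "(\<lambda>x. K x y) \<in> borel_measurable half_line"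
      using K \<open>0 < y\<close> by (simp add: measurable_kernel_def)
    have "(\<lambda>x::real. complex_of_real (x powr b0)) \<in> borel_measurable borel" by measurable
    then have [measurable]: "(\<lambda>x::real. complex_of_real (x powr b0)) \<in> borel_measurable half_line"
      by (intro measurable_restrict_space1 measurable_completion) simp
    note window_power_measurable[measurable]
    show "transform_integrand b0 K (window_power r a) y \<in> borel_measurable half_line"
      unfolding transform_integrand_def[abs_def] by measurable
    show "emeasure half_line {a..2 * a} < \<infinity>"
      using assms by (subst emeasure_restrict_space) auto
    show "AE x in half_line. x \<in> {a..2 * a} \<longrightarrow>
        norm (transform_integrand b0 K (window_power r a) y x) \<le> A * B"
    proof (intro AE_I2 impI)
      fix x assume x: "x \<in> {a..2 * a}"
      have "0 \<le> A" using A[OF x] order_trans[OF powr_ge_zero] by blast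
      have "norm (transform_integrand b0 K (window_power r a) y x)
          = x powr (b0 + r) * norm (K x y)"
        using x by (simp add: transform_integrand_def window_power_def norm_mult powr_add)
      also have "\<dots> \<le> A * B"
        using x A B \<open>0 \<le> A\<close> by (intro mult_mono) auto
      finally show "norm (transform_integrand b0 K (window_power r a) y x) \<le> A * B" .
    qed
    show "AE x in half_line. x \<notin> {a..2 * a} \<longrightarrow> transform_integrand b0 K (window_power r a) y x = 0"
      by (auto simp: transform_integrand_def window_power_def)
  qed
qed

text \<open>
  The exponent \<open>- b0 - b\<close> cancels both \<open>x powr b0\<close> and the factor \<open>x powr b\<close> of the lower bound for
  the kernel: the real part of the integrand is at least \<open>k * y powr c\<close> on an interval of
  length \<open>a\<close>, and the norm of the integral is at least the integral of the real part.
\<close>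

lemma window_power_transform_lower_bound:
  assumes int: "integrable half_line (transform_integrand b0 K (window_power (- b0 - b) a) y)"
    and low: "\<And>x. x \<in> {a..2 * a} \<Longrightarrow> k * (x powr b * y powr c) \<le> Re (K x y)"
    and a: "0 < a" and y: "0 < y" and k: "0 < k"
  shows "k * a * y powr (c0 + c) \<le> norm (transform b0 c0 K (window_power (- b0 - b) a) y)"
proof -
  let ?T = "transform_integrand b0 K (window_power (- b0 - b) a) y"
  have meas: "measure half_line {a..2 * a} = a"
    using a by (subst measure_restrict_space) auto
  have inter: "{a..2 * a} \<inter> {0<..} = {a..2 * a}"
    using a by auto
  have set: "{a..2 * a} \<in> sets half_line"
    using a by (auto simp: sets_restrict_space_iff)
  have "k * y powr c * a = (LINT x|half_line. k * y powr c * indicator {a..2 * a} x)"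
    using a meas by (simp add: inter)
  also have "\<dots> \<le> (LINT x|half_line. Re (?T x))"
  proof (rule integral_mono)
    have "emeasure half_line {a..2 * a} < \<infinity>"
      using a by (subst emeasure_restrict_space) auto
    then show "integrable half_line (\<lambda>x. k * y powr c * indicator {a..2 * a} x)"
      using set by (intro integrable_mult_right integrable_real_indicator) auto
    show "integrable half_line (\<lambda>x. Re (?T x))"
      using int by (rule integrable_Re)
    fix x assume "x \<in> space half_line"
    show "k * y powr c * indicator {a..2 * a} x \<le> Re (?T x)"
    proof (cases "x \<in> {a..2 * a}")
      case True
      then have x: "0 < x" using a by auto
      have "k * y powr c = x powr (- b) * (k * (x powr b * y powr c))"
        using x by (simp add: powr_minus)
      also have "\<dots> \<le> x powr (- b) * Re (K x y)"
        using True by (intro mult_left_mono low) auto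
      also have "\<dots> = Re (?T x)"
      proof -
        have "x powr b0 * x powr (- b0 - b) = x powr (- b)"
          by (simp flip: powr_add)
        then show ?thesis
          using True by (simp add: transform_integrand_def window_power_def flip: of_real_mult)
      qed
      finally show ?thesis using True by simp
    qed (simp add: transform_integrand_def window_power_def)
  qed
  also have "\<dots> = Re (LINT x|half_line. ?T x)"
    using int by simp
  also have "\<dots> \<le> norm (LINT x|half_line. ?T x)"
    by (rule complex_Re_le_cmod)
  finally have "y powr c0 * (k * y powr c * a) \<le> y powr c0 * norm (LINT x|half_line. ?T x)"
    by (rule mult_left_mono) simp
  then show ?thesis
    by (simp add: transform_def norm_mult powr_add mult_ac)
qed

text \<open>
  This is the common core of both parts of the theorem. The set \<open>E\<close> encodes a region of
  the quadrant that is invariant under \<open>(x, y) \<mapsto> (t x, y / t)\<close>, in which the kernel has a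
  lower bound of power type; this invariance is what lets the windows at all scales \<open>a\<close> yield the
  same estimate up to powers of \<open>a\<close>.
\<close>

lemma homogeneous_kernel_necessary:
  assumes p: "1 < p" and q: "0 < q"
    and K: "measurable_kernel K"
    and bdd: "\<And>S. compact S \<Longrightarrow> S \<subseteq> quadrant \<Longrightarrow> bounded ((\<lambda>(x, y). K x y) ` S)"
    and C: "0 < C" and ineq: "\<And>f. f \<in> borel_measurable half_line \<Longrightarrow>
           (\<And>y. 0 < y \<Longrightarrow> integrable half_line (transform_integrand b0 K f y)) \<Longrightarrow>
           lnorm q (\<lambda>y. of_real (y powr (- \<beta>)) * transform b0 c0 K f y)
             \<le> ennreal C * lnorm p (\<lambda>x. of_real (x powr \<gamma>) * f x)"
    and k: "0 < k"
    and low: "\<And>a x y. 0 < a \<Longrightarrow> 0 < y \<Longrightarrow> x \<in> {a..2 * a} \<Longrightarrow> a * y \<in> E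
           \<Longrightarrow> k * (x powr b * y powr c) \<le> Re (K x y)"
    and E: "E \<in> sets borel" "{u<..<v} \<subseteq> E" "0 \<le> u" "u < v"
  shows "power_mass (q * (c0 + c - \<beta>)) E < \<infinity>"
    and "\<beta> = \<gamma> + c0 - b0 + c - b + 1 / q - 1 / conjugate_exponent p"
proof -
  define s where "s = q * (c0 + c - \<beta>)"
  define t where "t = (\<gamma> + (- b0 - b)) * p"
  define M where "M = enn2real (power_mass t {1..2})"
  have M: "0 < M"
    unfolding M_def using power_mass_compact_finite[of 1 t 2] power_mass_interval_pos[of "{1..2}" 1 2 t]
    by (auto simp: enn2real_positive_iff greaterThanLessThan_subseteq_atLeastAtMost_iff)
  \<comment> \<open>The norm inequality for the window at scale \<open>a\<close>, raised to the power \<open>q\<close>, with the left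
    side bounded below and the right side computed.\<close>
  have key: "ennreal (k powr q * a powr (q - s - 1)) * power_mass s E
      \<le> ennreal (C powr q * M powr (q / p) * a powr ((t + 1) * (q / p)))" if a: "0 < a" for a
  proof -
    let ?f = "window_power (- b0 - b) a"
    let ?B = "C * (a powr (t + 1) * M) powr (1 / p)"
    have int: "integrable half_line (transform_integrand b0 K ?f y)" if "0 < y" for y
      using K bdd a that by (rule window_power_integrable)
    have "lnorm q (\<lambda>y. of_real (y powr (- \<beta>)) * transform b0 c0 K ?f y)
        \<le> ennreal C * lnorm p (\<lambda>x. of_real (x powr \<gamma>) * ?f x)"
      by (intro ineq window_power_measurable int)
    also have "\<dots> = ennreal ?B"
      using a p C by (simp add: window_power_norm M_def t_def flip: ennreal_mult)
    finally have up: "(\<integral>\<^sup>+y. ennreal (norm (of_real (y powr (- \<beta>)) * transform b0 c0 K ?f y) powr q)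
        \<partial>half_line) \<le> ennreal (?B powr q)"
      using q C by (intro lnorm_le_imp_nn_integral_le) auto
    have "ennreal (k powr q * a powr (q - s - 1)) * power_mass s E
        = ennreal ((k * a) powr q) * (ennreal (a powr (- s - 1)) * power_mass s E)"
    proof -
      have "k powr q * a powr (q - s - 1) = (k * a) powr q * a powr (- s - 1)"
        using a k powr_add[of a q "- s - 1"] by (simp add: powr_mult add_diff_eq)
      then show ?thesis by (simp add: ennreal_mult mult.assoc)
    qed
    also have "\<dots> = ennreal ((k * a) powr q) * power_mass s {y. a * y \<in> E}"
      using E a by (simp add: power_mass_dilate)
    also have "\<dots> = (\<integral>\<^sup>+y. ennreal ((k * a) powr q) * (ennreal (y powr s) * indicator {y. a * y \<in> E} y)
        \<partial>half_line)"
    proof -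
      have [measurable]: "E \<in> sets borel" by (fact E)
      have "(\<lambda>y. ennreal (y powr s) * indicator {y. a * y \<in> E} y) \<in> borel_measurable borel"
        by measurable
      then have "(\<lambda>y. ennreal (y powr s) * indicator {y. a * y \<in> E} y) \<in> borel_measurable half_line"
        by (intro measurable_restrict_space1 measurable_completion) simp
      then show ?thesis
        by (simp add: power_mass_def nn_integral_cmult)
    qed
    also have "\<dots> \<le> (\<integral>\<^sup>+y. ennreal (norm (of_real (y powr (- \<beta>)) * transform b0 c0 K ?f y) powr q)
        \<partial>half_line)"
    proof (rule nn_integral_mono)
      fix y assume "y \<in> space half_line"
      then have y: "0 < y" by (simp add: space_restrict_space)
      show "ennreal ((k * a) powr q) * (ennreal (y powr s) * indicator {y. a * y \<in> E} y)
          \<le> ennreal (norm (of_real (y powr (- \<beta>)) * transform b0 c0 K ?f y) powr q)"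
      proof (cases "a * y \<in> E")
        case True
        have "k * a * y powr (c0 + c) \<le> norm (transform b0 c0 K ?f y)"
          using int[OF y] low[OF a y _ True] a y k by (rule window_power_transform_lower_bound)
        then have "y powr (- \<beta>) * (k * a * y powr (c0 + c))
            \<le> norm (of_real (y powr (- \<beta>)) * transform b0 c0 K ?f y)"
          by (simp add: norm_mult mult_left_mono)
        moreover have "y powr (- \<beta>) * (k * a * y powr (c0 + c)) = k * a * y powr (c0 + c - \<beta>)"
          by (simp add: powr_add powr_diff powr_minus field_simps)
        ultimately have "(k * a * y powr (c0 + c - \<beta>)) powr q
            \<le> norm (of_real (y powr (- \<beta>)) * transform b0 c0 K ?f y) powr q"
          using q k a by (intro powr_mono2) auto
        then have "(k * a) powr q * y powr s
            \<le> norm (of_real (y powr (- \<beta>)) * transform b0 c0 K ?f y) powr q"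
          using k a by (simp add: powr_mult powr_powr s_def mult.commute)
        then show ?thesis
          using True by (simp add: ennreal_leI flip: ennreal_mult)
      qed simp
    qed
    also have "\<dots> \<le> ennreal (?B powr q)" by (fact up)
    also have "?B powr q = C powr q * M powr (q / p) * a powr ((t + 1) * (q / p))"
      using a C M by (simp add: powr_mult powr_powr)
    finally show ?thesis .
  qed
  have "ennreal (k powr q) * power_mass s E < \<infinity>"
    using key[of 1] by (auto intro: order_le_less_trans)
  then have fin: "power_mass s E < \<infinity>"
    using k by (auto simp: ennreal_mult_less_top)
  then show "power_mass (q * (c0 + c - \<beta>)) E < \<infinity>"
    by (simp add: s_def)
  define D where "D = enn2real (power_mass s E)"
  have D: "power_mass s E = ennreal D" "0 < D"
    using fin power_mass_interval_pos[OF E, of s] by (auto simp: D_def enn2real_positive_iff)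
  have "q - s - 1 = (t + 1) * (q / p)"
  proof (rule powr_dominated_imp_eq)
    show "0 < k powr q * D" "0 < C powr q * M powr (q / p)"
      using k D C M by auto
    show "k powr q * D * a powr (q - s - 1)
        \<le> C powr q * M powr (q / p) * a powr ((t + 1) * (q / p))" if "0 < a" for a
      using key[OF that] D C M by (simp add: mult_ac flip: ennreal_mult)
  qed
  then show "\<beta> = \<gamma> + c0 - b0 + c - b + 1 / q - 1 / conjugate_exponent p"
    using p q by (simp add: s_def t_def conjugate_exponent_def field_simps)
qed

lemma kernel_asymp_lower_bound:
  assumes "kernel_asymp S K b c"
  obtains k where "0 < k" and "\<And>x y. (x, y) \<in> S \<Longrightarrow> k * (x powr b * y powr c) \<le> Re (K x y)"
proof -
  obtain d where d: "0 < d" "\<And>x y. (x, y) \<in> S \<Longrightarrow> x powr b * y powr c \<le> d * Re (K x y)"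
    using assms unfolding kernel_asymp_def asymp_on_set_def lesssim_on_def by fast
  show thesis
    by (rule that[of "1 / d"]) (use d in \<open>auto simp: field_simps\<close>)
qed

section \<open>Necessary conditions\<close>

theorem theorem4p1:
  fixes p q b0 c0 \<beta> \<gamma> :: real
    and K :: "real \<Rightarrow> real \<Rightarrow> complex"
  assumes "1 < p" and "p \<le> q"
    and "measurable_kernel K"
    and "\<And>S. compact S \<Longrightarrow> S \<subseteq> quadrant \<Longrightarrow> bounded ((\<lambda>(x, y). K x y) ` S)"
    and "\<exists>C::real. C > 0 \<and>
      (\<forall>f. f \<in> borel_measurable half_line \<longrightarrow>
           (\<forall>y>0. integrable half_line (transform_integrand b0 K f y)) \<longrightarrow>
           lnorm q (\<lambda>y. of_real (y powr (- \<beta>)) * transform b0 c0 K f y)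
             \<le> ennreal C * lnorm p (\<lambda>x. of_real (x powr \<gamma>) * f x))"
  shows "(\<forall>b1 c1.
            kernel_asymp {(x, y). x > 0 \<and> y > 0 \<and> x * y \<le> 1} K b1 c1 \<longrightarrow>
            \<beta> = \<gamma> + c0 - b0 + c1 - b1 + 1 / q - 1 / conjugate_exponent p \<and>
            \<beta> < 1 / q + c0 + c1) \<and>
         (\<forall>b2 c2.
            kernel_asymp {(x, y). x > 0 \<and> y > 0 \<and> x * y > 1} K b2 c2 \<longrightarrow>
            \<beta> = \<gamma> + c0 - b0 + c2 - b2 + 1 / q - 1 / conjugate_exponent p \<and>
            \<beta> > 1 / q + c0 + c2)"
proof -
  obtain C where C: "0 < C" and ineq: "\<And>f. f \<in> borel_measurable half_line \<Longrightarrow>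
       (\<And>y. 0 < y \<Longrightarrow> integrable half_line (transform_integrand b0 K f y)) \<Longrightarrow>
       lnorm q (\<lambda>y. of_real (y powr (- \<beta>)) * transform b0 c0 K f y)
         \<le> ennreal C * lnorm p (\<lambda>x. of_real (x powr \<gamma>) * f x)"
    using assms(5) by blast
  have q: "0 < q" using assms by linarith
  show ?thesis
  proof (intro conjI allI impI)
    fix b1 c1
    assume "kernel_asymp {(x, y). x > 0 \<and> y > 0 \<and> x * y \<le> 1} K b1 c1"
    then obtain k where k: "0 < k" and "\<And>x y. (x, y) \<in> {(x, y). x > 0 \<and> y > 0 \<and> x * y \<le> 1}
        \<Longrightarrow> k * (x powr b1 * y powr c1) \<le> Re (K x y)"
      by (rule kernel_asymp_lower_bound) blast
    \<comment> \<open>The bound \<open>1 / 2\<close> rather than \<open>1\<close> absorbs the factor \<open>2\<close> in \<open>x \<le> 2 a\<close>.\<close>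
    moreover have "x * y \<le> 1" if "0 < y" "x \<in> {a..2 * a}" "a * y \<in> {0<..1 / 2}" for a x y :: real
    proof -
      have "x * y \<le> 2 * a * y" using that by (intro mult_right_mono) auto
      also have "\<dots> \<le> 1" using that by simp
      finally show ?thesis .
    qed
    ultimately have low: "k * (x powr b1 * y powr c1) \<le> Re (K x y)"
      if "0 < a" "0 < y" "x \<in> {a..2 * a}" "a * y \<in> {0<..1 / 2}" for a x y
      using that by force
    have E: "{0<..1 / 2 :: real} \<in> sets borel" "{0<..<1 / 2} \<subseteq> {0<..1 / 2 :: real}"
      "0 \<le> (0 :: real)" "0 < 1 / (2 :: real)"
      by auto
    have finite: "power_mass (q * (c0 + c1 - \<beta>)) {0<..1 / 2} < \<infinity>"
      and eq: "\<beta> = \<gamma> + c0 - b0 + c1 - b1 + 1 / q - 1 / conjugate_exponent p"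
      by (rule homogeneous_kernel_necessary[where E = "{0<..1 / 2}" and u = "0" and v = "1 / 2"
            and p = p and q = q and C = C and K = K and \<gamma> = \<gamma> and k = k and b = b1 and c = c1];
          fact assms q C ineq k low E)+
    show "\<beta> = \<gamma> + c0 - b0 + c1 - b1 + 1 / q - 1 / conjugate_exponent p"
      by (fact eq)
    \<comment> \<open>The dilate \<open>{y. 2 y \<in> (0, 1/2]}\<close> is \<open>(0, 1/4]\<close>.\<close>
    from finite have "2 powr (- (q * (c0 + c1 - \<beta>)) - 1) < (1 :: real)"
      by (intro power_mass_shrink_exponent[where E = "{0<..1 / 2}" and u = "1 / 4" and v = "1 / 2"]) auto
    then have "- 1 < q * (c0 + c1 - \<beta>)"
      using powr_less_cancel_iff[of 2 "- (q * (c0 + c1 - \<beta>)) - 1" 0] by simp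
    then show "\<beta> < 1 / q + c0 + c1"
      using q by (simp add: field_simps)
  next
    fix b2 c2
    assume "kernel_asymp {(x, y). x > 0 \<and> y > 0 \<and> x * y > 1} K b2 c2"
    then obtain k where k: "0 < k" and "\<And>x y. (x, y) \<in> {(x, y). x > 0 \<and> y > 0 \<and> x * y > 1}
        \<Longrightarrow> k * (x powr b2 * y powr c2) \<le> Re (K x y)"
      by (rule kernel_asymp_lower_bound) blast
    moreover have "x * y > 1" if "0 < y" "x \<in> {a..2 * a}" "a * y \<in> {1<..}" for a x y :: real
    proof -
      have "1 < a * y" using that by simp
      also have "\<dots> \<le> x * y" using that by (intro mult_right_mono) auto
      finally show ?thesis .
    qed
    ultimately have low: "k * (x powr b2 * y powr c2) \<le> Re (K x y)"
      if "0 < a" "0 < y" "x \<in> {a..2 * a}" "a * y \<in> {1<..}" for a x y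
      using that by force
    have E: "{1 :: real<..} \<in> sets borel" "{1<..<2} \<subseteq> {1 :: real<..}"
      "0 \<le> (1 :: real)" "1 < (2 :: real)"
      by auto
    have finite: "power_mass (q * (c0 + c2 - \<beta>)) {1<..} < \<infinity>"
      and eq: "\<beta> = \<gamma> + c0 - b0 + c2 - b2 + 1 / q - 1 / conjugate_exponent p"
      by (rule homogeneous_kernel_necessary[where E = "{1<..}" and u = "1" and v = "2"
            and p = p and q = q and C = C and K = K and \<gamma> = \<gamma> and k = k and b = b2 and c = c2];
          fact assms q C ineq k low E)+
    show "\<beta> = \<gamma> + c0 - b0 + c2 - b2 + 1 / q - 1 / conjugate_exponent p"
      by (fact eq)
    \<comment> \<open>The dilate \<open>{y. y / 2 \<in> (1, \<infinity>)}\<close> is \<open>(2, \<infinity>)\<close>.\<close>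
    from finite have "(1 / 2) powr (- (q * (c0 + c2 - \<beta>)) - 1) < (1 :: real)"
      by (intro power_mass_shrink_exponent[where E = "{1<..}" and u = 1 and v = 2]) auto
    then have "q * (c0 + c2 - \<beta>) < - 1"
      using powr_less_cancel_iff[of 2 0 "- (q * (c0 + c2 - \<beta>)) - 1"] by (simp add: powr_divide)
    then show "\<beta> > 1 / q + c0 + c2"
      using q by (simp add: field_simps)
  qed
qed

end
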